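(* Let $\Phi$ be a root system of type $F_4$, and let $\hat I\subseteq\Phi^+$ be the order ideal of the root poset consisting of all positive roots of height at most $4$. For an order ideal $I\subseteq\Phi^+$ in the root poset, the following are equivalent: (a) $I$ is supersolvable; (b) $I$ is chain peelable; (c) $I\not\supseteq\hat I$.
   Context: Let $\Phi$ be a finite crystallographic root system with positive roots $\Phi^+$ and simple roots $\Delta\subseteq\Phi^+$. Every $\gamma\in\Phi^+$ is uniquely $\gamma=\sum_{\alpha\in\Delta}\gamma_\alpha\alpha$ with nonnegative integers $\gamma_\alpha$; its height is $\sum_{\alpha\in\Delta}\gamma_\alpha$. The root poset is the partial order on $\Phi^+$ given by $\gamma\le\gamma'$ iff $\gamma_\alpha\le\gamma'_\alpha$ for all $\alpha\in\Delta$. An order ideal is a subset $I\subseteq\Phi^+$ such that $\gamma_1\in I$ and $\gamma_2<\gamma_1$ imply $\gamma_2\in I$. In type $F_4$ label the simple roots $\alpha_1,\alpha_2,\alpha_3,\alpha_4$ along the Dynkin diagram so that $\alpha_1,\alpha_2$ are short, $\alpha_3,\alpha_4$ are long, and the double bond joins $\alpha_2$ and $\alpha_3$ (so $2\alpha_2+\alpha_3$ is a root). Then $\hat I$ is the order ideal generated by the three roots of height $4$: $\eta_1=\alpha_1+2\alpha_2+\alpha_3$, $\eta_2=\alpha_1+\alpha_2+\alpha_3+\alpha_4$, $\eta_3=2\alpha_2+\alpha_3+\alpha_4$. For a finite set $\mathcal{A}$ of pairwise non-parallel vectors in a Euclidean space (such as $\mathcal{A}=I$), the closure of $S\subseteq\mathcal{A}$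 is $\mathrm{cl}(S)=\mathcal{A}\cap\mathrm{span}\,S$; a flat is a closed subset; the rank of a subset is the dimension of its span; a $k$-flat is a flat of rank $k$. $\mathcal{A}$ is supersolvable if, with $n$ the rank of $\mathcal{A}$, there is a partition $\mathcal{A}=\Pi_1\uplus\cdots\uplus\Pi_n$ such that for all $i\in\{1,\dots,n\}$, setting $\mathcal{A}_i=\Pi_1\uplus\cdots\uplus\Pi_i$: (1) $\mathcal{A}_i$ has rank $i$; (2) no $2$-flat of $\mathcal{A}_i$ is a subset of $\Pi_i$. A chain in a poset is a totally ordered subset; an order filter is the complement of an order ideal. Chain peelings of a finite poset $P$ are defined recursively. If $P$ is a chain, then $P$ is a chain peeling of itself (with one block; the empty poset is chain peelable). Otherwise, a chain peeling of $P$ is a partition $P=P_1\uplus\cdots\uplus P_n$, $n\ge2$, such that $P_n$ is an order filter of $P$ containing a minimal element of $P$, $P_n$ is a chain, and $P_1\uplus\cdots\uplus P_{n-1}$ is a chain peeling of $P\setminus P_n$. $P$ is chain peelable if it has a chain peeling. The ideal $I$ is regarded as a poset with the order induced from the root poset. *)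

theory Defs
  imports "HOL-Analysis.Analysis"
begin

section \<open>Root systems and the root poset\<close>

definition cartan_number :: "'a::euclidean_space \<Rightarrow> 'a \<Rightarrow> real" where
  "cartan_number \<beta> \<alpha> = 2 * (\<beta> \<bullet> \<alpha>) / (\<alpha> \<bullet> \<alpha>)"

definition root_reflection :: "'a::euclidean_space \<Rightarrow> 'a \<Rightarrow> 'a" where
  "root_reflection \<alpha> \<beta> = \<beta> - cartan_number \<beta> \<alpha> *\<^sub>R \<alpha>"

definition root_system :: "'a::euclidean_space set \<Rightarrow> bool" where
  "root_system \<Phi> \<longleftrightarrow>
     finite \<Phi> \<and> 0 \<notin> \<Phi> \<and> span \<Phi> = UNIV \<and>
     (\<forall>\<alpha>\<in>\<Phi>. \<Phi> \<inter> range (\<lambda>c. c *\<^sub>R \<alpha>) = {\<alpha>, - \<alpha>}) \<and>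
     (\<forall>\<alpha>\<in>\<Phi>. root_reflection \<alpha> ` \<Phi> = \<Phi>) \<and>
     (\<forall>\<alpha>\<in>\<Phi>. \<forall>\<beta>\<in>\<Phi>. cartan_number \<beta> \<alpha> \<in> \<int>)"

definition simple_system :: "'a::euclidean_space set \<Rightarrow> 'a set \<Rightarrow> bool" where
  "simple_system \<Phi> \<Delta> \<longleftrightarrow>
     \<Delta> \<subseteq> \<Phi> \<and> independent \<Delta> \<and>
     (\<forall>\<gamma>\<in>\<Phi>. \<exists>c :: 'a \<Rightarrow> nat.
        \<gamma> = (\<Sum>\<alpha>\<in>\<Delta>. real (c \<alpha>) *\<^sub>R \<alpha>) \<or> \<gamma> = - (\<Sum>\<alpha>\<in>\<Delta>. real (c \<alpha>) *\<^sub>R \<alpha>))"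

definition positive_roots :: "'a::euclidean_space set \<Rightarrow> 'a set \<Rightarrow> 'a set" where
  "positive_roots \<Phi> \<Delta> = {\<gamma>\<in>\<Phi>. \<exists>c :: 'a \<Rightarrow> nat. \<gamma> = (\<Sum>\<alpha>\<in>\<Delta>. real (c \<alpha>) *\<^sub>R \<alpha>)}"

text \<open>The coefficient \<open>\<gamma>\<^sub>\<alpha>\<close> is \<open>representation \<Delta> \<gamma> \<alpha>\<close>; it is a nonnegative integer
  (as a real number) for positive roots.\<close>

definition root_height :: "'a::euclidean_space set \<Rightarrow> 'a \<Rightarrow> real" where
  "root_height \<Delta> \<gamma> = (\<Sum>\<alpha>\<in>\<Delta>. representation \<Delta> \<gamma> \<alpha>)"

definition root_le :: "'a::euclidean_space set \<Rightarrow> 'a \<Rightarrow> 'a \<Rightarrow> bool" where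
  "root_le \<Delta> \<gamma> \<gamma>' \<longleftrightarrow> (\<forall>\<alpha>\<in>\<Delta>. representation \<Delta> \<gamma> \<alpha> \<le> representation \<Delta> \<gamma>' \<alpha>)"

text \<open>The simple roots \<open>\<alpha> 0, \<alpha> 1\<close> are short, \<open>\<alpha> 2, \<alpha> 3\<close> are long, and the double bond joins
  \<open>\<alpha> 1\<close> and \<open>\<alpha> 2\<close>: the entry \<open>-2\<close> says that reflecting \<open>\<alpha> 2\<close> in \<open>\<alpha> 1\<close> gives \<open>\<alpha> 2 + 2 \<alpha> 1\<close>.\<close>

definition cartan_matrix_F4 :: "int list list" where
  "cartan_matrix_F4 =
    [[ 2, -1,  0,  0],
     [-1,  2, -1,  0],
     [ 0, -2,  2, -1],
     [ 0,  0, -1,  2]]"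

definition type_F4 :: "'a::euclidean_space set \<Rightarrow> bool" where
  "type_F4 \<Delta> \<longleftrightarrow>
     (\<exists>\<alpha> :: nat \<Rightarrow> 'a. bij_betw \<alpha> {..<4} \<Delta> \<and>
        (\<forall>i<4. \<forall>j<4. cartan_number (\<alpha> i) (\<alpha> j) = of_int (cartan_matrix_F4 ! i ! j)))"

section \<open>Posets, given by an order relation and a carrier set\<close>

definition order_ideal :: "('a \<Rightarrow> 'a \<Rightarrow> bool) \<Rightarrow> 'a set \<Rightarrow> 'a set \<Rightarrow> bool" where
  "order_ideal le P J \<longleftrightarrow>
     J \<subseteq> P \<and> (\<forall>x\<in>J. \<forall>y\<in>P. le y x \<and> y \<noteq> x \<longrightarrow> y \<in> J)"

definition order_filter :: "('a \<Rightarrow> 'a \<Rightarrow> bool) \<Rightarrow> 'a set \<Rightarrow> 'a set \<Rightarrow> bool" where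
  "order_filter le P F \<longleftrightarrow> F \<subseteq> P \<and> order_ideal le P (P - F)"

definition is_chain :: "('a \<Rightarrow> 'a \<Rightarrow> bool) \<Rightarrow> 'a set \<Rightarrow> bool" where
  "is_chain le C \<longleftrightarrow> (\<forall>x\<in>C. \<forall>y\<in>C. le x y \<or> le y x)"

definition minimal_in :: "('a \<Rightarrow> 'a \<Rightarrow> bool) \<Rightarrow> 'a set \<Rightarrow> 'a \<Rightarrow> bool" where
  "minimal_in le P m \<longleftrightarrow> m \<in> P \<and> \<not> (\<exists>x\<in>P. le x m \<and> x \<noteq> m)"

text \<open>\<open>chain_peeling le P Bs\<close>: the list \<open>Bs = [P\<^sub>1, \<dots>, P\<^sub>n]\<close> of blocks is a chain peeling of \<open>P\<close>.
  The blocks partition \<open>P\<close> by construction, since \<open>P\<^sub>1, \<dots>, P\<^sub>n\<^sub>-\<^sub>1\<close> come from a chain peeling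
  of \<open>P - P\<^sub>n\<close>; also \<open>n \<ge> 2\<close> in the second rule, since every peeling has at least one block.\<close>

inductive chain_peeling :: "('a \<Rightarrow> 'a \<Rightarrow> bool) \<Rightarrow> 'a set \<Rightarrow> 'a set list \<Rightarrow> bool"
  for le :: "'a \<Rightarrow> 'a \<Rightarrow> bool" where
  chain: "is_chain le P \<Longrightarrow> chain_peeling le P [P]"
| peel: "\<not> is_chain le P \<Longrightarrow> order_filter le P F \<Longrightarrow> (\<exists>m\<in>F. minimal_in le P m) \<Longrightarrow>
    is_chain le F \<Longrightarrow> chain_peeling le (P - F) Bs \<Longrightarrow> chain_peeling le P (Bs @ [F])"

definition chain_peelable :: "('a \<Rightarrow> 'a \<Rightarrow> bool) \<Rightarrow> 'a set \<Rightarrow> bool" where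
  "chain_peelable le P \<longleftrightarrow> (\<exists>Bs. chain_peeling le P Bs)"

section \<open>Flats and supersolvability\<close>

text \<open>These notions are intended for finite sets of pairwise non-parallel vectors, such as
  sets of positive roots.  The rank of a set is its dimension \<^const>\<open>dim\<close>.\<close>

definition flat_closure :: "'a::euclidean_space set \<Rightarrow> 'a set \<Rightarrow> 'a set" where
  "flat_closure A S = A \<inter> span S"

definition is_flat :: "'a::euclidean_space set \<Rightarrow> 'a set \<Rightarrow> bool" where
  "is_flat A X \<longleftrightarrow> X \<subseteq> A \<and> flat_closure A X = X"

definition k_flat :: "'a::euclidean_space set \<Rightarrow> nat \<Rightarrow> 'a set \<Rightarrow> bool" where
  "k_flat A k X \<longleftrightarrow> is_flat A X \<and> dim X = k"

definition supersolvable :: "'a::euclidean_space set \<Rightarrow> bool" where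
  "supersolvable A \<longleftrightarrow>
     (\<exists>B :: nat \<Rightarrow> 'a set.
        disjoint_family_on B {1..dim A} \<and> A = (\<Union>i\<in>{1..dim A}. B i) \<and>
        (\<forall>i\<in>{1..dim A}. let A' = (\<Union>j\<in>{1..i}. B j) in
           dim A' = i \<and> \<not> (\<exists>X. k_flat A' 2 X \<and> X \<subseteq> B i)))"

end

theory Submission
  imports Defs
begin

text \<open>If an ideal \<open>I\<close> omits one of the roots \<open>\<eta>\<^sub>i\<close> of height 4, then for a suitable ordering of the simple
  roots the sets of roots of \<open>I\<close> involving the first simple root, of the remaining roots involving the
  second one, and so on, are chains.  This is a chain peeling.  Its blocks also give supersolvability:
  if \<open>\<beta> < \<gamma>\<close> lie in a chain of all roots below \<open>\<gamma>\<close> involving the simple root \<open>\<alpha>\<close>, then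
  \<open>\<gamma>\<^sub>\<alpha> \<beta> - \<beta>\<^sub>\<alpha> \<gamma>\<close> is a multiple of a root below \<open>\<gamma>\<close>, which does not involve \<open>\<alpha>\<close> any more.

  If \<open>I\<close> contains all \<open>\<eta>\<^sub>i\<close>, then above every simple root there are two incomparable \<open>\<eta>\<^sub>i\<close>, so no filter
  containing a minimal element is a chain.  A supersolvable partition would yield a subset \<open>M\<close> of rank
  3 that meets every 2-flat of \<open>I\<close> and contains every 2-flat of which it contains two elements.
  A propositional argument on few 2-flats shows that \<open>M\<close> contains all simple roots, a
  contradiction.\<close>

section \<open>Coefficient vectors of the positive roots\<close>

text \<open>A positive root is encoded by its list of coefficients at \<open>\<alpha> 0, \<dots>, \<alpha> 3\<close>.\<close>

definition roots_F4 :: "int list list" where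
  "roots_F4 =
    [[0,0,0,1], [0,0,1,0], [0,1,0,0], [1,0,0,0],
     [0,0,1,1], [0,1,1,0], [1,1,0,0],
     [0,1,1,1], [0,2,1,0], [1,1,1,0],
     [0,2,1,1], [1,1,1,1], [1,2,1,0],
     [0,2,2,1], [1,2,1,1], [2,2,1,0],
     [1,2,2,1], [2,2,1,1],
     [1,3,2,1], [2,2,2,1],
     [2,3,2,1], [2,4,2,1], [2,4,3,1], [2,4,3,2]]"

text \<open>The roots \<open>\<eta>\<^sub>1, \<eta>\<^sub>2, \<eta>\<^sub>3\<close> of height 4, which generate the ideal of all roots of height at most 4.\<close>

definition gens4 :: "int list list" where
  "gens4 = [[1,2,1,0], [1,1,1,1], [0,2,1,1]]"

definition unit4 :: "nat \<Rightarrow> int list" where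
  "unit4 j = [0,0,0,0][j := 1]"

definition pairing4 :: "int list \<Rightarrow> nat \<Rightarrow> int" where
  "pairing4 c j = (\<Sum>i\<leftarrow>[0,1,2,3]. c ! i * cartan_matrix_F4 ! i ! j)"

definition reflect4 :: "nat \<Rightarrow> int list \<Rightarrow> int list" where
  "reflect4 j c = c[j := c ! j - pairing4 c j]"

text \<open>Index ranges are written as lists so that \<open>code_simp\<close> can evaluate the
  finite checks; \<open>less4_set\<close> translates them to \<open>{..<4}\<close>.\<close>

definition le4 :: "int list \<Rightarrow> int list \<Rightarrow> bool" where
  "le4 c d \<longleftrightarrow> (\<forall>i\<in>set [0,1,2,3]. c ! i \<le> d ! i)"

text \<open>The 3-by-3 minor, in columns \<open>i\<close>, \<open>j\<close>, \<open>k\<close>, of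
  the matrix with rows \<open>b\<close>, \<open>c\<close>, \<open>d\<close>. Its vanishing tests
  linear dependence in integer arithmetic.\<close>

definition minor4 :: "int list \<Rightarrow> int list \<Rightarrow> int list \<Rightarrow> nat \<Rightarrow> nat \<Rightarrow> nat \<Rightarrow> int" where
  "minor4 b c d i j k =
     b ! i * (c ! j * d ! k - c ! k * d ! j) - b ! j * (c ! i * d ! k - c ! k * d ! i)
       + b ! k * (c ! i * d ! j - c ! j * d ! i)"

definition on_line4 :: "int list \<Rightarrow> int list \<Rightarrow> int list \<Rightarrow> bool" where
  "on_line4 b c d \<longleftrightarrow> (\<forall>i\<in>set [0,1,2,3]. \<forall>j\<in>set [0,1,2,3]. \<forall>k\<in>set [0,1,2,3]. minor4 b c d i j k = 0)"

definition down4 :: "int list set \<Rightarrow> bool" where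
  "down4 K \<longleftrightarrow> K \<subseteq> set roots_F4 \<and> (\<forall>c\<in>K. \<forall>d\<in>set roots_F4. le4 d c \<longrightarrow> d \<in> K)"

text \<open>Fifteen of the 122 rank-two flats of the set of positive roots.  They were found by a search and
  already rule out a part of codimension one that meets every line of an ideal containing
  the roots of height at most 4; only two roots of larger height are involved.\<close>

definition test_lines :: "int list list list" where
  "test_lines =
    [[[0,0,0,1], [0,2,1,0], [0,2,1,1]],
     [[0,0,1,0], [0,1,0,0], [0,1,1,0], [0,2,1,0]],
     [[0,0,1,0], [0,1,1,1]],
     [[0,0,1,0], [1,1,0,0], [1,1,1,0], [2,2,1,0]],
     [[0,0,1,1], [1,1,1,0]],
     [[0,1,0,0], [0,0,1,1], [0,1,1,1], [0,2,1,1]],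
     [[0,1,1,1], [0,2,1,0]],
     [[0,2,1,0], [1,1,1,0]],
     [[0,2,1,1], [1,1,1,1]],
     [[1,0,0,0], [0,1,1,0], [1,1,1,0]],
     [[1,0,0,0], [0,1,1,1], [1,1,1,1]],
     [[1,0,0,0], [0,2,1,0], [1,2,1,0], [2,2,1,0]],
     [[1,1,0,0], [0,2,1,0]],
     [[1,1,1,1], [1,2,1,0], [2,3,2,1]],
     [[1,1,1,1], [2,2,1,0]]]"

text \<open>A checkable certificate for a peeling along supports: \<open>js\<close> names the simple
  roots whose up-sets are cut off, with the last block of the peeling first.\<close>

fun peel_order :: "int list list \<Rightarrow> nat list \<Rightarrow> bool" where
  "peel_order xs [] \<longleftrightarrow> xs = []"
| "peel_order xs (j # js) \<longleftrightarrow>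
     (\<forall>c\<in>set xs. \<forall>d\<in>set xs. 0 < c ! j \<longrightarrow> 0 < d ! j \<longrightarrow> le4 c d \<or> le4 d c) \<and>
     peel_order (filter (\<lambda>c. c ! j = 0) xs) js"

section \<open>Finite checks on the list of roots\<close>

lemma less4_set: "set [0,1,2,3] = {..<4::nat}"
  by auto

lemma roots_entries: "\<forall>c\<in>set roots_F4. length c = 4 \<and> (\<forall>i\<in>set[0,1,2,3]. 0 \<le> c ! i) \<and> (\<exists>i\<in>set[0,1,2,3]. 0 < c ! i)"
  by code_simp

lemma roots_reflect: "\<forall>c\<in>set roots_F4. \<forall>j\<in>set [0,1,2,3].
     0 \<le> c ! j - pairing4 c j \<longrightarrow> reflect4 j c \<in> set roots_F4"
  by code_simp

text \<open>Simple reflections lead from every list entry down to a simple root without leaving the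
  list, which drives the induction in \<open>vec_root\<close>.\<close>

lemma roots_descend: "\<forall>c\<in>set roots_F4. c \<in> set (map unit4 [0,1,2,3]) \<or>
    (\<exists>j\<in>set [0,1,2,3]. 0 < pairing4 c j \<and> reflect4 j c \<in> set roots_F4)"
  by code_simp

lemma low_root_le_gens: "\<forall>c\<in>set roots_F4. sum_list c \<le> 4 \<longrightarrow> (\<exists>d\<in>set gens4. le4 c d)"
  by code_simp

text \<open>The chain condition is imposed only below \<open>c\<close>, so one check serves every
  ideal containing \<open>c\<close>. Eliminating the coefficient at \<open>j\<close> from
  \<open>b\<close> and \<open>c\<close> gives \<open>k\<close> times a positive root;
  \<open>k\<close> may be negative because the combination need not be positive.\<close>

lemma chain_line:
  "\<forall>j\<in>set [0,1,2,3]. \<forall>c\<in>set roots_F4. 0 < c ! j \<longrightarrow>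
     (\<forall>x\<in>set roots_F4. le4 x c \<and> 0 < x ! j \<longrightarrow>
        (\<forall>y\<in>set roots_F4. le4 y c \<and> 0 < y ! j \<longrightarrow> le4 x y \<or> le4 y x)) \<longrightarrow>
     (\<forall>b\<in>set roots_F4. le4 b c \<and> 0 < b ! j \<and> b \<noteq> c \<longrightarrow>
       (\<exists>d\<in>set roots_F4. le4 d c \<and> d ! j = 0 \<and>
         (\<exists>k\<in>set [1,2,3,-1,-2,-3]. \<forall>i\<in>set [0,1,2,3]. k * d ! i = c ! j * b ! i - b ! j * c ! i)))"
  by code_simp

lemma roots_unit: "\<forall>j\<in>set [0,1,2,3]. unit4 j \<in> set roots_F4"
  by code_simp

text \<open>The ideals avoiding a root \<open>e\<close> lie in the largest one, and peeling orders pass to smaller ideals.\<close>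

lemma peel_orders:
  "\<forall>(e, js)\<in>set [([1,2,1,0], [0,3,1,2]), ([1,1,1,1], [0,3,1,2]), ([0,2,1,1], [3,0,1,2])].
     peel_order (filter (\<lambda>c. \<not> le4 e c) roots_F4) js"
  by code_simp

lemma unit_le: "\<forall>c\<in>set roots_F4. \<forall>j\<in>set [0,1,2,3]. 0 < c ! j \<longrightarrow> le4 (unit4 j) c"
  by code_simp

lemma unit_minimal: "\<forall>c\<in>set roots_F4. \<forall>j\<in>set [0,1,2,3]. le4 c (unit4 j) \<longrightarrow> c = unit4 j"
  by code_simp

lemma ideal_nonchain: "\<forall>j\<in>set [0,1,2,3]. \<exists>c\<in>set gens4.
   \<exists>d\<in>set gens4. le4 (unit4 j) c \<and> le4 (unit4 j) d \<and> \<not> le4 c d \<and> \<not> le4 d c"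
  by code_simp

lemma generators_height: "\<forall>c\<in>set gens4. c \<in> set roots_F4 \<and> sum_list c \<le> 4"
  by code_simp

lemma test_lines_flats:
  "\<forall>l\<in>set test_lines. set l \<subseteq> set roots_F4 \<and> (\<forall>b\<in>set l. \<forall>c\<in>set l. b \<noteq> c \<longrightarrow>
     (\<forall>d\<in>set roots_F4. on_line4 b c d \<longleftrightarrow> d \<in> set l))"
  by code_simp

text \<open>\<open>M\<close> plays the part of the union of all blocks but the last in a
  supersolvable partition. The instances of \<open>meet\<close> and \<open>flat\<close> at
  \<open>test_lines\<close> form a propositional problem about membership in \<open>K\<close> and
  \<open>M\<close>.\<close>

lemma hyperplane_contains_simple:
  assumes K: "down4 K" "set gens4 \<subseteq> K" and "M \<subseteq> K"
    and meet: "\<And>l b c. l \<in> set test_lines \<Longrightarrow> b \<in> set l \<Longrightarrow> c \<in> set l \<Longrightarrow> b \<noteq> c \<Longrightarrow> b \<in> K \<Longrightarrow> c \<in> K \<Longrightarrow>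
      \<exists>d\<in>set l. d \<in> M"
    and flat: "\<And>l b c d. l \<in> set test_lines \<Longrightarrow> b \<in> set l \<Longrightarrow> c \<in> set l \<Longrightarrow> d \<in> set l \<Longrightarrow> b \<noteq> c \<Longrightarrow>
      b \<in> M \<Longrightarrow> c \<in> M \<Longrightarrow> d \<in> K \<Longrightarrow> d \<in> M"
  shows "\<forall>j\<in>set [0,1,2,3]. unit4 j \<in> M"
proof -
  have small: "\<forall>c\<in>set roots_F4. sum_list c \<le> 4 \<longrightarrow> c \<in> K"
    using low_root_le_gens K unfolding down4_def by fastforce
  have c1: "\<forall>l\<in>set test_lines. \<forall>b\<in>set l. \<forall>c\<in>set l. b \<noteq> c \<longrightarrow> b \<in> K \<longrightarrow> c \<in> K \<longrightarrow> (\<exists>d\<in>set l. d \<in> M)"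
    using meet by blast
  have c2: "\<forall>l\<in>set test_lines. \<forall>b\<in>set l. \<forall>c\<in>set l. b \<noteq> c \<longrightarrow> b \<in> M \<longrightarrow> c \<in> M \<longrightarrow>
     (\<forall>d\<in>set l. d \<in> K \<longrightarrow> d \<in> M)"
    using flat by blast
  \<comment> \<open>The only roots of height above 4 in \<open>test_lines\<close> are
    \<open>[2,3,2,1]\<close> and \<open>[2,2,1,0]\<close>, so their membership in \<open>K\<close>
    stays open. This implication and the next supply what is used about it.\<close>
  have "[2,3,2,1] \<in> M \<longrightarrow> [2,3,2,1] \<in> K" using assms(3) by blast
  moreover have "[2,3,2,1] \<in> K \<longrightarrow> [2,2,1,0] \<in> K"
    using K(1) unfolding down4_def by (auto simp: le4_def roots_F4_def)
  moreover note small' = small[unfolded roots_F4_def, simplified]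
  moreover note c1[unfolded test_lines_def, simplified small', simplified]
  moreover note c2[unfolded test_lines_def, simplified small', simplified]
  ultimately have "[0,0,0,1] \<in> M \<and> [0,0,1,0] \<in> M \<and> [0,1,0,0] \<in> M \<and> [1,0,0,0] \<in> M"
    by sat
  then show ?thesis by (simp add: unit4_def)
qed

section \<open>Geometry of supersolvable sets\<close>

text \<open>The elements of \<open>A\<close> in the plane of \<open>x\<close> and \<open>y\<close>
  form a 2-flat, which cannot lie within \<open>P\<close>.\<close>

lemma line_meets_complement:
  fixes A P :: "'a::euclidean_space set"
  assumes "\<not> (\<exists>X. k_flat A 2 X \<and> X \<subseteq> P)" "x \<in> A" "y \<in> A" "x \<noteq> y" "independent {x, y}"
  obtains z where "z \<in> A" "z \<notin> P" "z \<in> span {x, y}"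
proof -
  have sub: "{x, y} \<subseteq> A \<inter> span {x, y}" using assms by (auto intro: span_base)
  have "span (A \<inter> span {x, y}) = span {x, y}"
    using sub by (meson Int_lower2 span_mono span_span subset_antisym span_minimal subspace_span)
  moreover from this have "dim (A \<inter> span {x, y}) = 2"
    using assms(4,5) by (metis card_2_iff dim_eq_card_independent dim_span)
  ultimately have "k_flat A 2 (A \<inter> span {x, y})"
    by (simp add: k_flat_def is_flat_def flat_closure_def)
  then show ?thesis using assms(1) that by blast
qed

text \<open>If \<open>z \<in> P\<close>, the line through \<open>z\<close> and some \<open>w \<notin> span M\<close> would meet \<open>M\<close> outside \<open>z\<close>,
  putting \<open>w\<close> into \<open>span M\<close>.\<close>

lemma line_closed:
  fixes A M P :: "'a::euclidean_space set"
  assumes "\<not> (\<exists>X. k_flat A 2 X \<and> X \<subseteq> P)" and A: "A = M \<union> P" and "M \<inter> P = {}" and "dim M < dim A"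
    and indep: "\<And>x y. x \<in> A \<Longrightarrow> y \<in> A \<Longrightarrow> x \<noteq> y \<Longrightarrow> independent {x, y}"
    and z: "z \<in> A" "z \<in> span M"
  shows "z \<in> M"
proof (rule ccontr)
  assume "z \<notin> M"
  have "\<not> A \<subseteq> span M" using dim_subset[of A "span M"] assms(4) by (auto simp: dim_span)
  then obtain w where w: "w \<in> A" "w \<notin> span M" by blast
  then have "w \<noteq> z" using z by blast
  then have "independent {w, z}" using indep w z by blast
  obtain u where u: "u \<in> A" "u \<notin> P" "u \<in> span {w, z}"
    by (rule line_meets_complement[OF assms(1) w(1) z(1) \<open>w \<noteq> z\<close> \<open>independent {w, z}\<close>])
  then have "u \<in> M" "u \<noteq> z" using A \<open>z \<notin> M\<close> z by blast+
  then have "independent {u, z}" using indep u z by blast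
  then have "u \<notin> span {z}" using \<open>u \<noteq> z\<close> by (simp add: independent_insert)
  \<comment> \<open>Exchange property: \<open>u\<close> lies in the span of \<open>w\<close> and
    \<open>z\<close> but not in that of \<open>z\<close> alone.\<close>
  then have "w \<in> span {u, z}" using in_span_insert[OF u(3)] by blast
  also have "\<dots> \<subseteq> span M" using \<open>u \<in> M\<close> z by (simp add: span_minimal span_base)
  finally show False using w by blast
qed

text \<open>Appending \<open>P\<close> as a new last block leaves the earlier partial unions
  unchanged, so only the conditions at the new index have to be supplied.\<close>

lemma supersolvable_extend:
  fixes A P :: "'a::euclidean_space set"
  assumes "supersolvable A" "A \<inter> P = {}" "dim (A \<union> P) = Suc (dim A)"
    and "\<not> (\<exists>X. k_flat (A \<union> P) 2 X \<and> X \<subseteq> P)"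
  shows "supersolvable (A \<union> P)"
proof -
  let ?n = "dim A"
  obtain B where B: "disjoint_family_on B {1..?n}" "A = (\<Union>i\<in>{1..?n}. B i)"
    "\<forall>i\<in>{1..?n}. dim (\<Union>j\<in>{1..i}. B j) = i \<and>
        \<not> (\<exists>X. k_flat (\<Union>j\<in>{1..i}. B j) 2 X \<and> X \<subseteq> B i)"
    using assms(1) unfolding supersolvable_def Let_def by (elim exE conjE) (rule that)
  \<comment> \<open>The values of \<open>B\<close> outside \<open>{1..dim A}\<close> are arbitrary,
    so the next index is free for \<open>P\<close>.\<close>
  define C where "C = B(Suc ?n := P)"
  have low: "(\<Union>j\<in>{1..i}. C j) = (\<Union>j\<in>{1..i}. B j)" if "i \<le> ?n" for i
    using that by (auto simp: C_def)
  have top: "(\<Union>j\<in>{1..Suc ?n}. C j) = A \<union> P"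
  proof -
    have "(\<Union>j\<in>{1..Suc ?n}. C j) = (\<Union>j\<in>{1..?n}. C j) \<union> C (Suc ?n)"
      by (simp add: atLeastAtMostSuc_conv Un_commute)
    also have "\<dots> = A \<union> P" unfolding low[OF order_refl] B(2)[symmetric] by (simp add: C_def)
    finally show ?thesis .
  qed
  have "disjoint_family_on C {1..Suc ?n}"
    unfolding disjoint_family_on_def
  proof (intro ballI impI)
    fix m n assume mn: "m \<in> {1..Suc ?n}" "n \<in> {1..Suc ?n}" "m \<noteq> n"
    have BP: "B i \<inter> P = {}" if "i \<in> {1..?n}" for i using that assms(2) B(2) by blast
    consider "m = Suc ?n" "n \<in> {1..?n}" | "n = Suc ?n" "m \<in> {1..?n}"
      | "m \<in> {1..?n}" "n \<in> {1..?n}"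
      using mn by fastforce
    then show "C m \<inter> C n = {}"
    proof cases
      case 1
      then show ?thesis using BP[of n] by (auto simp: C_def)
    next
      case 2
      then show ?thesis using BP[of m] by (auto simp: C_def)
    next
      case 3
      then show ?thesis using disjoint_family_onD[OF B(1) 3 mn(3)] by (simp add: C_def)
    qed
  qed
  moreover have "dim (\<Union>j\<in>{1..i}. C j) = i \<and> \<not> (\<exists>X. k_flat (\<Union>j\<in>{1..i}. C j) 2 X \<and> X \<subseteq> C i)"
    if "i \<in> {1..Suc ?n}" for i
  proof (cases "i = Suc ?n")
    case True
    then show ?thesis using top assms(3,4) by (simp add: C_def)
  next
    case False
    then have "i \<in> {1..?n}" using that by auto
    then show ?thesis using B(3)[rule_format, of i] low[of i] by (simp add: C_def)
  qed
  ultimately show ?thesis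
    unfolding supersolvable_def Let_def assms(3) using top by blast
qed

lemma supersolvable_last:
  fixes A :: "'a::euclidean_space set"
  assumes "supersolvable A" "2 \<le> dim A"
  obtains M P where "A = M \<union> P" "M \<inter> P = {}" "dim M < dim A" "\<not> (\<exists>X. k_flat A 2 X \<and> X \<subseteq> P)"
proof -
  obtain B where B: "disjoint_family_on B {1..dim A}" "A = (\<Union>i\<in>{1..dim A}. B i)"
    "\<forall>i\<in>{1..dim A}. dim (\<Union>j\<in>{1..i}. B j) = i \<and>
        \<not> (\<exists>X. k_flat (\<Union>j\<in>{1..i}. B j) 2 X \<and> X \<subseteq> B i)"
    using assms(1) unfolding supersolvable_def Let_def by (elim exE conjE) (rule that)
  \<comment> \<open>With \<open>1 \<le> n\<close>, the index \<open>n\<close> is in the range of the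
    rank condition, which gives the union of the first \<open>n\<close> blocks rank
    \<open>n\<close>.\<close>
  obtain n where n: "dim A = Suc n" "1 \<le> n" using assms(2) by (metis Suc_le_D Suc_1 Suc_le_mono One_nat_def)
  show ?thesis
  proof (rule that)
    show "A = (\<Union>j\<in>{1..n}. B j) \<union> B (dim A)"
      by (subst B(2)) (auto simp: n atLeastAtMostSuc_conv)
    show "(\<Union>j\<in>{1..n}. B j) \<inter> B (dim A) = {}"
    proof -
      have "B j \<inter> B (Suc n) = {}" if "j \<in> {1..n}" for j
        using disjoint_family_onD[OF B(1), of j "Suc n"] that n by simp
      then show ?thesis unfolding n by blast
    qed
    show "dim (\<Union>j\<in>{1..n}. B j) < dim A" using B(3)[rule_format, of n] n by simp
    show "\<not> (\<exists>X. k_flat A 2 X \<and> X \<subseteq> B (dim A))"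
      using B(3)[rule_format, of "dim A"] B(2) n by simp
  qed
qed

section \<open>Root systems of type F4\<close>

text \<open>Fixes one labelling of the Dynkin diagram, of which \<open>type_F4\<close> asserts only
  the existence.\<close>

locale F4_roots =
  fixes \<Phi> \<Delta> :: "'a::euclidean_space set" and \<alpha> :: "nat \<Rightarrow> 'a"
  assumes roots: "root_system \<Phi>"
    and simples: "simple_system \<Phi> \<Delta>"
    and bij: "bij_betw \<alpha> {..<4} \<Delta>"
    and cartan: "\<And>i j. i < 4 \<Longrightarrow> j < 4 \<Longrightarrow>
      cartan_number (\<alpha> i) (\<alpha> j) = of_int (cartan_matrix_F4 ! i ! j)"
begin

definition vec :: "int list \<Rightarrow> 'a" where
  "vec c = (\<Sum>i<4. of_int (c ! i) *\<^sub>R \<alpha> i)"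

section \<open>Coordinates with respect to the simple roots\<close>

lemma simple_eq: "\<Delta> = \<alpha> ` {..<4}" and inj_simple: "inj_on \<alpha> {..<4}"
  using bij by (auto simp: bij_betw_def)

lemma indep: "independent \<Delta>"
  using simples by (simp add: simple_system_def)

lemma sum_simple: "(\<Sum>a\<in>\<Delta>. h a) = (\<Sum>i<4. h (\<alpha> i))"
  using inj_simple by (simp add: simple_eq sum.reindex)

lemma representation_comb:
  assumes "j < 4"
  shows "representation \<Delta> (\<Sum>i<4. x i *\<^sub>R \<alpha> i) (\<alpha> j) = x j"
proof -
  \<comment> \<open>The coefficients are transported along \<alpha> to a function on
    \<open>\<Delta>\<close>, over which \<open>representation\<close> is expanded.\<close>
  let ?y = "\<lambda>b. x (the_inv_into {..<4} \<alpha> b)"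
  have y: "?y (\<alpha> i) = x i" if "i < 4" for i
    using that inj_simple by (simp add: the_inv_into_f_f)
  have eq: "(\<Sum>i<4. x i *\<^sub>R \<alpha> i) = (\<Sum>b\<in>\<Delta>. ?y b *\<^sub>R b)"
    unfolding simple_eq using inj_simple y by (simp add: sum.reindex)
  have "representation \<Delta> (\<Sum>b\<in>\<Delta>. ?y b *\<^sub>R b) (\<alpha> j) = (\<Sum>b\<in>\<Delta>. representation \<Delta> (?y b *\<^sub>R b) (\<alpha> j))"
    using indep by (subst representation_sum) (auto intro: span_mul span_base)
  also have "\<dots> = (\<Sum>b\<in>\<Delta>. ?y b * (if b = \<alpha> j then 1 else 0))"
    using indep by (intro sum.cong refl)
      (simp add: representation_scale span_base representation_basis)
  also have "\<dots> = (\<Sum>b\<in>\<Delta>. if b = \<alpha> j then ?y (\<alpha> j) else 0)"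
    by (intro sum.cong) auto
  also have "\<dots> = x j"
    using assms y[OF assms] by (simp add: simple_eq)
  finally show ?thesis using eq by simp
qed

lemma comb_eq_iff:
  "(\<Sum>i<4. x i *\<^sub>R \<alpha> i) = (\<Sum>i<4. y i *\<^sub>R \<alpha> i) \<longleftrightarrow> (\<forall>i<4. x i = y i)"
  by (metis (mono_tags, lifting) lessThan_iff representation_comb sum.cong)

lemma representation_vec: "j < 4 \<Longrightarrow> representation \<Delta> (vec c) (\<alpha> j) = of_int (c ! j)"
  unfolding vec_def by (rule representation_comb)

lemma vec_eq_iff: "length c = 4 \<Longrightarrow> length d = 4 \<Longrightarrow> vec c = vec d \<longleftrightarrow> c = d"
  by (auto simp: vec_def comb_eq_iff list_eq_iff_nth_eq)

lemma root_le_vec: "root_le \<Delta> (vec c) (vec d) \<longleftrightarrow> le4 c d"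
  unfolding root_le_def le4_def less4_set simple_eq
  using representation_vec unfolding simple_eq by simp

lemma root_height_vec: "length c = 4 \<Longrightarrow> root_height \<Delta> (vec c) = of_int (sum_list c)"
proof -
  assume c: "length c = 4"
  have "root_height \<Delta> (vec c) = (\<Sum>i<4. representation \<Delta> (vec c) (\<alpha> i))"
    unfolding root_height_def by (rule sum_simple)
  also have "\<dots> = (\<Sum>i<4. of_int (c ! i))"
    by (intro sum.cong refl) (simp add: representation_vec)
  also have "\<dots> = of_int (sum_list c)"
    using c by (simp add: sum_list_sum_nth lessThan_atLeast0)
  finally show ?thesis .
qed

lemma pairing_eq: "pairing4 c j = (\<Sum>i<4. c ! i * cartan_matrix_F4 ! i ! j)"
proof -
  have "{..<4::nat} = {0,1,2,3}" by auto
  then show ?thesis by (simp add: pairing4_def)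
qed

lemma cartan_number_vec: "j < 4 \<Longrightarrow> cartan_number (vec c) (\<alpha> j) = of_int (pairing4 c j)"
proof -
  assume j: "j < 4"
  have "cartan_number (vec c) (\<alpha> j) = (\<Sum>i<4. of_int (c ! i) * cartan_number (\<alpha> i) (\<alpha> j))"
    by (simp add: cartan_number_def vec_def inner_sum_left sum_distrib_left sum_divide_distrib mult_ac)
  also have "\<dots> = of_int (pairing4 c j)"
    using j by (simp add: pairing_eq cartan)
  finally show ?thesis .
qed

lemma vec_update:
  assumes "j < 4" "length c = 4"
  shows "vec (c[j := c ! j + n]) = vec c + of_int n *\<^sub>R \<alpha> j"
proof -
  have "vec (c[j := c ! j + n]) = (\<Sum>i<4. of_int (c ! i) *\<^sub>R \<alpha> i + (if i = j then of_int n *\<^sub>R \<alpha> j else 0))"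
    unfolding vec_def using assms by (intro sum.cong) (auto simp: algebra_simps)
  then show ?thesis using assms by (simp add: sum.distrib vec_def)
qed

lemma reflect_vec:
  assumes "j < 4" "length c = 4"
  shows "root_reflection (\<alpha> j) (vec c) = vec (reflect4 j c)"
  using vec_update[OF assms, of "- pairing4 c j"] assms
  by (simp add: root_reflection_def cartan_number_vec reflect4_def)

section \<open>The listed vectors are exactly the positive roots\<close>

lemma simple_in_roots: "j < 4 \<Longrightarrow> \<alpha> j \<in> \<Phi>"
  using simples by (auto simp: simple_eq simple_system_def)

lemma reflect_closed:
  assumes "j < 4" "length c = 4" "vec c \<in> \<Phi>"
  shows "vec (reflect4 j c) \<in> \<Phi>"
proof -
  have "root_reflection (\<alpha> j) ` \<Phi> = \<Phi>"
    using roots simple_in_roots[OF assms(1)] by (simp add: root_system_def)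
  then show ?thesis using reflect_vec[OF assms(1,2)] assms(3) by (metis imageI)
qed

text \<open>As \<open>c\<close> is arbitrary, no finite check applies. The pairing is computed
  through the geometric reflection, using that \<open>\<alpha> j\<close> has Cartan number 2 with
  itself.\<close>

lemma reflect_reflect:
  assumes "j < 4" "length c = 4"
  shows "pairing4 (reflect4 j c) j = - pairing4 c j" "reflect4 j (reflect4 j c) = c"
proof -
  have l: "length (reflect4 j c) = 4" using assms by (simp add: reflect4_def)
  have self: "cartan_number (\<alpha> j) (\<alpha> j) = 2"
  proof -
    have "\<alpha> j \<noteq> 0" using simple_in_roots[OF assms(1)] roots by (auto simp: root_system_def)
    then show ?thesis by (simp add: cartan_number_def)
  qed
  have "of_int (pairing4 (reflect4 j c) j) = cartan_number (root_reflection (\<alpha> j) (vec c)) (\<alpha> j)"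
    using assms by (simp add: reflect_vec cartan_number_vec)
  also have "\<dots> = cartan_number (vec c) (\<alpha> j) - cartan_number (vec c) (\<alpha> j) * cartan_number (\<alpha> j) (\<alpha> j)"
    unfolding root_reflection_def by (simp add: cartan_number_def inner_diff_left diff_divide_distrib algebra_simps)
  also have "\<dots> = of_int (- pairing4 c j)"
    using assms by (simp add: self cartan_number_vec)
  finally show *: "pairing4 (reflect4 j c) j = - pairing4 c j" by linarith
  show "reflect4 j (reflect4 j c) = c"
    unfolding reflect4_def[of _ "reflect4 j c"] * using assms by (simp add: reflect4_def)
qed

lemma vec_unit: "j < 4 \<Longrightarrow> vec (unit4 j) = \<alpha> j"
proof -
  assume j: "j < 4"
  have "unit4 j ! i = (if i = j then 1 else 0)" if "i < 4" for i
    using that j by (auto simp: unit4_def nth_list_update less_Suc_eq numeral_eq_Suc)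
  then have "vec (unit4 j) = (\<Sum>i<4. if i = j then \<alpha> j else 0)"
    unfolding vec_def by (intro sum.cong) auto
  then show ?thesis using j by simp
qed

lemma roots_length: "c \<in> set roots_F4 \<Longrightarrow> length c = 4"
  using roots_entries by blast

lemma roots_nonneg: "c \<in> set roots_F4 \<Longrightarrow> i < 4 \<Longrightarrow> 0 \<le> c ! i"
  using roots_entries less4_set by blast

lemma sum_list4: "length c = 4 \<Longrightarrow> sum_list c = (\<Sum>i<4. c ! i)"
  by (simp add: sum_list_sum_nth lessThan_atLeast0)

lemma sum_reflect: "length c = 4 \<Longrightarrow> j < 4 \<Longrightarrow> sum_list (reflect4 j c) = sum_list (c :: int list) - pairing4 c j"
proof -
  assume c: "length c = 4" and j: "j < 4"
  have "sum_list (reflect4 j c) = (\<Sum>i<4. c ! i + (if i = j then - pairing4 c j else 0))"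
    using c j by (subst sum_list4) (auto simp: reflect4_def intro!: sum.cong)
  then show ?thesis using c j by (simp add: sum.distrib sum_list4)
qed

text \<open>Induction on the height: a list entry that is not simple is reflected to a lower one,
  which is a root by induction, and reflecting back stays in \<open>\<Phi>\<close>.\<close>

lemma vec_root: "c \<in> set roots_F4 \<Longrightarrow> vec c \<in> \<Phi>"
proof (induction "nat (sum_list c)" arbitrary: c rule: less_induct)
  case less
  note c = less.prems
  show ?case
  proof (cases "c \<in> set (map unit4 [0,1,2,3])")
    case True
    then show ?thesis using vec_unit simple_in_roots by auto
  next
    case False
    then obtain j where j: "j < 4" "0 < pairing4 c j" "reflect4 j c \<in> set roots_F4"
      using roots_descend c less4_set by blast
    have l: "length c = 4" using c roots_length by blast
    have "0 \<le> sum_list (reflect4 j c)"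
      using roots_nonneg[OF j(3)] roots_length[OF j(3)] by (auto simp: sum_list4 intro!: sum_nonneg)
    then have "nat (sum_list (reflect4 j c)) < nat (sum_list c)"
      using j l by (simp add: sum_reflect)
    then have "vec (reflect4 j c) \<in> \<Phi>" using less.hyps j by blast
    then show ?thesis
      using reflect_closed[of j "reflect4 j c"] reflect_reflect[OF j(1) l] j roots_length by metis
  qed
qed

lemma signed_coeffs:
  assumes "vec c \<in> \<Phi>"
  shows "(\<forall>i<4. 0 \<le> c ! i) \<or> (\<forall>i<4. c ! i \<le> 0)"
proof -
  obtain f :: "'a \<Rightarrow> nat" where
    "vec c = (\<Sum>a\<in>\<Delta>. real (f a) *\<^sub>R a) \<or> vec c = - (\<Sum>a\<in>\<Delta>. real (f a) *\<^sub>R a)"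
    using simples assms unfolding simple_system_def by blast
  moreover have "(\<Sum>a\<in>\<Delta>. real (f a) *\<^sub>R a) = (\<Sum>i<4. real (f (\<alpha> i)) *\<^sub>R \<alpha> i)"
    by (rule sum_simple)
  ultimately consider "vec c = (\<Sum>i<4. real (f (\<alpha> i)) *\<^sub>R \<alpha> i)"
    | "vec c = (\<Sum>i<4. (- real (f (\<alpha> i))) *\<^sub>R \<alpha> i)"
    by (auto simp: sum_negf)
  then show ?thesis
  proof cases
    case 1
    then have "\<forall>i<4. of_int (c ! i) = real (f (\<alpha> i))" unfolding vec_def comb_eq_iff .
    then show ?thesis by (metis of_int_0_le_iff of_nat_0_le_iff)
  next
    case 2
    then have "\<forall>i<4. of_int (c ! i) = - real (f (\<alpha> i))" unfolding vec_def comb_eq_iff .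
    then show ?thesis by (metis neg_le_0_iff_le of_int_le_0_iff of_nat_0_le_iff)
  qed
qed

lemma unit_root: "j < 4 \<Longrightarrow> unit4 j \<in> set roots_F4"
  using roots_unit less4_set by blast

text \<open>Induction on the height. Positivity of the inner product of \<open>vec c\<close> with
  itself yields a simple root in the support whose reflection lowers the height. Either the result
  is again nonnegative, or \<open>vec c\<close> is a multiple of that simple root, hence equal to
  it.\<close>

lemma nonneg_root_mem:
  assumes "vec c \<in> \<Phi>" "length c = 4" "\<forall>i<4. 0 \<le> c ! i"
  shows "c \<in> set roots_F4"
  using assms
proof (induction "nat (sum_list c)" arbitrary: c rule: less_induct)
  case less
  note c = less.prems
  have "vec c \<noteq> 0" using c roots by (auto simp: root_system_def)
  then have "0 < vec c \<bullet> vec c" by simp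
  also have "vec c \<bullet> vec c = (\<Sum>j<4. of_int (c ! j) * (vec c \<bullet> \<alpha> j))"
    by (subst (2) vec_def) (simp add: inner_sum_right)
  finally obtain j where j: "j < 4" and pos: "0 < of_int (c ! j) * (vec c \<bullet> \<alpha> j)"
    by (metis (no_types, lifting) lessThan_iff linorder_not_less sum_nonpos)
  then have cj: "0 < c ! j" and ip: "0 < vec c \<bullet> \<alpha> j"
    using c(3)[rule_format, OF j] by (auto simp: zero_less_mult_iff)
  have aj: "\<alpha> j \<noteq> 0" using simple_in_roots[OF j] roots by (auto simp: root_system_def)
  have "0 < cartan_number (vec c) (\<alpha> j)"
    using ip aj by (simp add: cartan_number_def)
  then have n: "0 < pairing4 c j" using j by (simp add: cartan_number_vec)
  have r: "vec (reflect4 j c) \<in> \<Phi>" using reflect_closed j c by blast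
  have ri: "reflect4 j c ! i = (if i = j then c ! j - pairing4 c j else c ! i)" if "i < 4" for i
    using that c j by (simp add: reflect4_def)
  show ?case
  proof (cases "0 \<le> c ! j - pairing4 c j")
    case True
    then have nn: "\<forall>i<4. 0 \<le> reflect4 j c ! i" using ri c by simp
    have l: "length (reflect4 j c) = 4" using c by (simp add: reflect4_def)
    have "0 \<le> sum_list (reflect4 j c)" using nn l by (auto simp: sum_list4 intro!: sum_nonneg)
    then have "nat (sum_list (reflect4 j c)) < nat (sum_list c)"
      using j n c by (simp add: sum_reflect)
    then have "reflect4 j c \<in> set roots_F4" using less.hyps r l nn by blast
    \<comment> \<open>The premise of \<open>roots_reflect\<close> for reflecting back: the
      coefficient restored at \<open>j\<close> is \<open>c ! j\<close>.\<close>
    moreover have "0 \<le> reflect4 j c ! j - pairing4 (reflect4 j c) j"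
      using reflect_reflect[OF j c(2)] ri[OF j] cj by simp
    ultimately have "reflect4 j (reflect4 j c) \<in> set roots_F4"
      using roots_reflect j less4_set by blast
    then show ?thesis using reflect_reflect[OF j c(2)] by simp
  next
    case False
    \<comment> \<open>The coefficients of a root share a sign. The one at \<open>j\<close> has
      become negative and the others are unchanged, so the others vanish.\<close>
    then have "\<forall>i<4. reflect4 j c ! i \<le> 0" using signed_coeffs[OF r] ri j by force
    then have z: "\<forall>i<4. i \<noteq> j \<longrightarrow> c ! i = 0" using ri c(3) by (metis order_antisym)
    have "vec c = (\<Sum>i<4. if i = j then of_int (c ! j) *\<^sub>R \<alpha> j else 0)"
      unfolding vec_def using z by (intro sum.cong) auto
    then have eq: "vec c = of_int (c ! j) *\<^sub>R \<alpha> j" using j by simp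
    then have "vec c \<in> \<Phi> \<inter> range (\<lambda>t. t *\<^sub>R \<alpha> j)" using c(1) by auto
    also have "\<dots> = {\<alpha> j, - \<alpha> j}" using roots simple_in_roots[OF j] by (simp add: root_system_def)
    finally have "vec c = \<alpha> j \<or> vec c = - \<alpha> j" by simp
    then have "(of_int (c ! j) - 1) *\<^sub>R \<alpha> j = 0 \<or> (of_int (c ! j) + 1) *\<^sub>R \<alpha> j = 0"
      using eq by (auto simp: algebra_simps)
    then have "c ! j = 1" using cj aj by auto
    then have "vec c = vec (unit4 j)" using eq j by (simp add: vec_unit)
    then have "c = unit4 j" using c(2) j unit_root roots_length vec_eq_iff by blast
    then show ?thesis using j unit_root by simp
  qed
qed

lemma positive_roots_eq: "positive_roots \<Phi> \<Delta> = vec ` set roots_F4"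
proof (intro equalityI subsetI)
  fix g assume "g \<in> positive_roots \<Phi> \<Delta>"
  then obtain f :: "'a \<Rightarrow> nat" where g: "g \<in> \<Phi>" "g = (\<Sum>a\<in>\<Delta>. real (f a) *\<^sub>R a)"
    unfolding positive_roots_def by blast
  define c where "c = map (\<lambda>i. int (f (\<alpha> i))) [0..<4]"
  have "g = (\<Sum>i<4. real (f (\<alpha> i)) *\<^sub>R \<alpha> i)"
    unfolding g(2) by (rule sum_simple)
  also have "\<dots> = vec c" unfolding vec_def c_def by (intro sum.cong) auto
  finally have "g = vec c" .
  moreover have "c \<in> set roots_F4"
    using g(1) \<open>g = vec c\<close> by (intro nonneg_root_mem) (auto simp: c_def)
  ultimately show "g \<in> vec ` set roots_F4" by blast
next
  fix g assume "g \<in> vec ` set roots_F4"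
  then obtain c where c: "c \<in> set roots_F4" "g = vec c" by blast
  define f where "f a = nat (c ! the_inv_into {..<4} \<alpha> a)" for a
  have "(\<Sum>a\<in>\<Delta>. real (f a) *\<^sub>R a) = (\<Sum>i<4. real (f (\<alpha> i)) *\<^sub>R \<alpha> i)"
    by (rule sum_simple)
  also have "\<dots> = g"
    unfolding c(2) vec_def using roots_nonneg[OF c(1)] inj_simple
    by (intro sum.cong) (auto simp: f_def the_inv_into_f_f)
  finally have "g = (\<Sum>a\<in>\<Delta>. real (f a) *\<^sub>R a)" ..
  then show "g \<in> positive_roots \<Phi> \<Delta>"
    unfolding positive_roots_def using vec_root[OF c(1)] c(2)
    by (intro CollectI conjI exI[of _ f]) auto
qed

section \<open>Rank and independence of sets of roots\<close>

lemma span_down: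
  assumes "down4 K"
  shows "span (vec ` K) = span (\<alpha> ` {j. j < 4 \<and> unit4 j \<in> K})"
proof (rule span_eq[THEN iffD2], intro conjI subsetI)
  fix x assume "x \<in> vec ` K"
  then obtain c where c: "c \<in> K" "x = vec c" by blast
  then have r: "c \<in> set roots_F4" using assms by (auto simp: down4_def)
  \<comment> \<open>A simple root in the support of \<open>c\<close> lies below \<open>c\<close>,
    hence in the ideal.\<close>
  have "of_int (c ! i) *\<^sub>R \<alpha> i \<in> span (\<alpha> ` {j. j < 4 \<and> unit4 j \<in> K})" if i: "i < 4" for i
  proof (cases "c ! i = 0")
    case False
    then have "0 < c ! i" using roots_nonneg[OF r i] by simp
    then have "le4 (unit4 i) c" using unit_le r i less4_set by blast
    then have "unit4 i \<in> K" using assms c unit_root[OF i] by (auto simp: down4_def)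
    then show ?thesis using i by (intro span_scale span_base) blast
  qed (simp add: span_zero)
  then show "x \<in> span (\<alpha> ` {j. j < 4 \<and> unit4 j \<in> K})"
    unfolding c(2) vec_def by (intro span_sum) auto
next
  fix x assume "x \<in> \<alpha> ` {j. j < 4 \<and> unit4 j \<in> K}"
  then have "x \<in> vec ` K" using vec_unit by force
  then show "x \<in> span (vec ` K)" by (rule span_base)
qed

lemma dim_down:
  assumes "down4 K"
  shows "dim (vec ` K) = card {j. j < 4 \<and> unit4 j \<in> K}"
proof -
  let ?S = "{j. j < 4 \<and> unit4 j \<in> K}"
  have ind: "independent (\<alpha> ` ?S)" by (rule independent_mono[OF indep]) (auto simp: simple_eq)
  have inj: "inj_on \<alpha> ?S" by (rule inj_on_subset[OF inj_simple]) auto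
  have "dim (span (\<alpha> ` ?S)) = card ?S"
    by (simp only: dim_span dim_eq_card_independent[OF ind] card_image[OF inj])
  then show ?thesis by (simp only: flip: span_down[OF assms]) simp
qed

text \<open>The only roots parallel to a root are itself and its negative, and the negative of a
  positive root is not positive.\<close>

lemma independent_roots:
  assumes "c \<in> set roots_F4" "d \<in> set roots_F4" "c \<noteq> d"
  shows "independent {vec c, vec d}"
proof -
  have ne: "vec c \<noteq> vec d" using assms vec_eq_iff roots_length by metis
  have nz: "vec d \<noteq> 0" using vec_root[OF assms(2)] roots by (auto simp: root_system_def)
  have "vec c \<noteq> - vec d"
  proof
    assume "vec c = - vec d"
    then have "(\<Sum>i<4. of_int (c ! i) *\<^sub>R \<alpha> i) = (\<Sum>i<4. (- of_int (d ! i)) *\<^sub>R \<alpha> i)"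
      by (simp add: vec_def sum_negf)
    then have eq: "\<forall>i<4. real_of_int (c ! i) = - of_int (d ! i)" unfolding comb_eq_iff .
    obtain i where i: "i < 4" "0 < c ! i" using roots_entries assms(1) less4_set by blast
    have "0 \<le> d ! i" using roots_nonneg[OF assms(2) i(1)] .
    then show False using eq i by fastforce
  qed
  have "vec c \<notin> span {vec d}"
  proof
    assume "vec c \<in> span {vec d}"
    then have "vec c \<in> \<Phi> \<inter> range (\<lambda>t. t *\<^sub>R vec d)"
      using vec_root[OF assms(1)] by (auto simp: span_singleton)
    also have "\<dots> = {vec d, - vec d}"
      using roots vec_root[OF assms(2)] by (simp add: root_system_def)
    finally show False using ne \<open>vec c \<noteq> - vec d\<close> by simp
  qed
  then show ?thesis using nz ne by (simp add: independent_insert)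
qed

section \<open>Lines as vanishing minors\<close>

lemma span_imp_on_line:
  assumes "vec d \<in> span {vec b, vec c}"
  shows "on_line4 b c d"
proof -
  obtain s t where "vec d = s *\<^sub>R vec b + t *\<^sub>R vec c"
    using assms by (auto simp: span_insert span_singleton algebra_simps)
  then have "vec d = (\<Sum>i<4. (s * of_int (b ! i) + t * of_int (c ! i)) *\<^sub>R \<alpha> i)"
    by (simp add: vec_def scaleR_sum_right sum.distrib scaleR_add_left)
  then have eq: "\<forall>i<4. real_of_int (d ! i) = s * of_int (b ! i) + t * of_int (c ! i)"
    by (simp add: vec_def comb_eq_iff)
  have "minor4 b c d i j k = 0" if "i < 4" "j < 4" "k < 4" for i j k
  proof -
    have "real_of_int (minor4 b c d i j k) = 0"
      using eq that by (simp add: minor4_def algebra_simps)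
    then show ?thesis by linarith
  qed
  then show ?thesis unfolding on_line4_def less4_set by simp
qed

text \<open>Cramer's rule: \<open>b\<close> and \<open>c\<close> have a nonzero 2-by-2 minor
  \<open>p\<close> in some columns \<open>i\<close>, \<open>j\<close>, and the vanishing 3-by-3
  minors containing these columns express \<open>p\<close> times \<open>d\<close> through
  \<open>b\<close> and \<open>c\<close>.\<close>

lemma span_if_on_line:
  assumes "on_line4 b c d" "b \<in> set roots_F4" "c \<in> set roots_F4" "b \<noteq> c"
  shows "vec d \<in> span {vec b, vec c}"
proof -
  have minor: "minor4 b c d i j k = 0" if "i < 4" "j < 4" "k < 4" for i j k
    using assms(1) that unfolding on_line4_def less4_set by simp
  have "\<exists>i<4. \<exists>j<4. b ! i * c ! j - b ! j * c ! i \<noteq> 0"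
  proof (rule ccontr)
    assume "\<not> ?thesis"
    then have z: "b ! i * c ! j = b ! j * c ! i" if "i < 4" "j < 4" for i j using that by auto
    obtain i where i: "i < 4" "0 < b ! i" using roots_entries assms(2) less4_set by blast
    have "of_int (b ! i) *\<^sub>R vec c = of_int (c ! i) *\<^sub>R vec b"
      unfolding vec_def scaleR_sum_right using z[OF i(1)]
      by (intro sum.cong refl) (simp flip: of_int_mult add: mult.commute)
    then have "(1 / of_int (b ! i)) *\<^sub>R (of_int (b ! i) *\<^sub>R vec c) =
        (1 / of_int (b ! i)) *\<^sub>R (of_int (c ! i) *\<^sub>R vec b)" by (rule arg_cong)
    then have "vec c = (of_int (c ! i) / of_int (b ! i)) *\<^sub>R vec b" using i by simp
    then have "vec c \<in> span {vec b}" by (auto simp: span_singleton)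
    moreover have "vec c \<noteq> vec b" using assms vec_eq_iff roots_length by metis
    ultimately show False
      using independent_roots[OF assms(3,2)] assms(4) by (auto simp: independent_insert)
  qed
  then obtain i j where ij: "i < 4" "j < 4" "b ! i * c ! j - b ! j * c ! i \<noteq> 0" by blast
  define p q r where "p = b ! i * c ! j - b ! j * c ! i"
    and "q = d ! i * c ! j - d ! j * c ! i" and "r = b ! i * d ! j - b ! j * d ! i"
  have "p * d ! k = q * b ! k + r * c ! k" if "k < 4" for k
    using minor[OF ij(1,2) that] by (simp add: minor4_def p_def q_def r_def algebra_simps)
  then have "of_int p *\<^sub>R vec d = of_int q *\<^sub>R vec b + of_int r *\<^sub>R vec c"
    unfolding vec_def scaleR_sum_right sum.distrib[symmetric]
    by (intro sum.cong refl) (simp flip: of_int_mult of_int_add scaleR_add_left)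
  also have "\<dots> \<in> span {vec b, vec c}" by (intro span_add span_scale span_base) auto
  finally have "(1 / of_int p) *\<^sub>R (of_int p *\<^sub>R vec d) \<in> span {vec b, vec c}" by (rule span_scale)
  then show ?thesis using ij(3) by (simp add: p_def flip: of_int_mult of_int_diff)
qed

section \<open>Ideals containing all three generators\<close>

lemma ideal_not_supersolvable:
  assumes K: "down4 K" "set gens4 \<subseteq> K"
  shows "\<not> supersolvable (vec ` K)"
proof
  assume ss: "supersolvable (vec ` K)"
  have KR: "K \<subseteq> set roots_F4" using K by (simp add: down4_def)
  have unit: "unit4 j \<in> K" if j: "j < 4" for j
  proof -
    have "j \<in> set [0,1,2,3]" using j less4_set by blast
    then obtain c where "c \<in> K" "le4 (unit4 j) c" using ideal_nonchain K(2) by blast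
    then show ?thesis using K(1) unit_root[OF j] by (auto simp: down4_def)
  qed
  then have "{j. j < 4 \<and> unit4 j \<in> K} = {..<4}" by auto
  then have "dim (vec ` K) = 4" using dim_down[OF K(1)] by simp
  then have "2 \<le> dim (vec ` K)" by simp
  obtain N P where NP: "vec ` K = N \<union> P" "N \<inter> P = {}" "dim N < dim (vec ` K)"
    "\<not> (\<exists>X. k_flat (vec ` K) 2 X \<and> X \<subseteq> P)"
    by (rule supersolvable_last[OF ss \<open>2 \<le> dim (vec ` K)\<close>])
  have ind: "independent {x, y}" if "x \<in> vec ` K" "y \<in> vec ` K" "x \<noteq> y" for x y
    using that independent_roots KR by blast
  define M where "M = {c\<in>K. vec c \<in> N}"
  have line: "set l \<subseteq> set roots_F4"
      "\<And>b c d. b \<in> set l \<Longrightarrow> c \<in> set l \<Longrightarrow> b \<noteq> c \<Longrightarrow> d \<in> set roots_F4 \<Longrightarrow> on_line4 b c d \<longleftrightarrow> d \<in> set l"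
    if "l \<in> set test_lines" for l
    using that test_lines_flats by blast+
  have "\<forall>j\<in>set [0,1,2,3]. unit4 j \<in> M"
  proof (rule hyperplane_contains_simple[OF K])
    show "M \<subseteq> K" by (auto simp: M_def)
  next
    fix l b c assume l: "l \<in> set test_lines" "b \<in> set l" "c \<in> set l" "b \<noteq> c" "b \<in> K" "c \<in> K"
    have ne: "vec b \<noteq> vec c" using l KR vec_eq_iff roots_length by (metis subsetD)
    have mem: "vec b \<in> vec ` K" "vec c \<in> vec ` K" using l by auto
    \<comment> \<open>The flat of \<open>vec b\<close> and \<open>vec c\<close> in the ideal is not
      inside the last block, so it meets \<open>N\<close>; the line test puts the common element on
      \<open>l\<close>.\<close>
    obtain z where z: "z \<in> vec ` K" "z \<notin> P" "z \<in> span {vec b, vec c}"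
      by (rule line_meets_complement[OF NP(4) mem ne ind[OF mem ne]])
    then obtain d where d: "d \<in> K" "z = vec d" by blast
    then have "d \<in> set l" using line(2)[OF l(1-4)] span_imp_on_line z KR by blast
    moreover have "d \<in> M" using d z NP(1) by (auto simp: M_def)
    ultimately show "\<exists>d\<in>set l. d \<in> M" by blast
  next
    fix l b c d assume l: "l \<in> set test_lines" "b \<in> set l" "c \<in> set l" "d \<in> set l" "b \<noteq> c"
      "b \<in> M" "c \<in> M" "d \<in> K"
    have "vec d \<in> span {vec b, vec c}"
      using l line[OF l(1)] KR by (intro span_if_on_line) blast+
    also have "\<dots> \<subseteq> span N" using l by (intro span_mono) (auto simp: M_def)
    finally have "vec d \<in> N" using line_closed[OF NP(4,1-3) ind] l by blast
    then show "d \<in> M" using l by (simp add: M_def)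
  qed
  then have "unit4 j \<in> M" if "j < 4" for j using that unfolding less4_set by simp
  \<comment> \<open>Four independent vectors in \<open>N\<close> contradict that its rank is below
    4.\<close>
  then have "\<alpha> ` {..<4} \<subseteq> N" by (auto simp: M_def simp flip: vec_unit)
  then have "card (\<alpha> ` {..<4}) \<le> dim N"
    using indep unfolding simple_eq by (metis dim_eq_card_independent dim_subset)
  then show False using NP(3) \<open>dim (vec ` K) = 4\<close> inj_simple by (simp add: card_image)
qed

lemma ideal_not_peelable:
  assumes K: "down4 K" "set gens4 \<subseteq> K"
  shows "\<not> chain_peelable (root_le \<Delta>) (vec ` K)"
proof
  assume "chain_peelable (root_le \<Delta>) (vec ` K)"
  then obtain Bs where "chain_peeling (root_le \<Delta>) (vec ` K) Bs" by (auto simp: chain_peelable_def)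
  then show False
  proof cases
    case chain
    then have *: "le4 c d \<or> le4 d c" if "c \<in> K" "d \<in> K" for c d
      using that by (simp add: is_chain_def root_le_vec)
    show False using *[of "[1,2,1,0]" "[0,2,1,1]"] K(2) by (auto simp: le4_def gens4_def)
  next
    case (peel F Cs)
    then obtain m where m: "m \<in> F" "minimal_in (root_le \<Delta>) (vec ` K) m" by blast
    then obtain a where a: "a \<in> K" "m = vec a" by (auto simp: minimal_in_def)
    then have aR: "a \<in> set roots_F4" using K by (auto simp: down4_def)
    obtain j where j: "j < 4" "0 < a ! j" using roots_entries aR less4_set by blast
    have le: "le4 (unit4 j) a" using unit_le aR j less4_set by blast
    then have "unit4 j \<in> K" using K(1) a unit_root[OF j(1)] by (auto simp: down4_def)
    \<comment> \<open>The simple root below \<open>a\<close> belongs to the ideal, so minimality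
      forces \<open>m\<close> to be that simple root.\<close>
    then have m_eq: "m = vec (unit4 j)"
      using m(2) le a(2) by (auto simp: minimal_in_def root_le_vec)
    \<comment> \<open>The complement of \<open>F\<close> is an ideal: if it contained
      \<open>vec c\<close>, it would also contain \<open>m\<close>.\<close>
    have up: "vec c \<in> F" if "c \<in> K" "le4 (unit4 j) c" for c
    proof (rule ccontr)
      assume "vec c \<notin> F"
      then have "vec c \<in> vec ` K - F" using that by blast
      moreover have "m \<noteq> vec c" using \<open>vec c \<notin> F\<close> m by blast
      moreover have "m \<in> vec ` K" using a by blast
      ultimately have "m \<in> vec ` K - F"
        using peel(3) that(2) unfolding order_filter_def order_ideal_def m_eq
        by (metis root_le_vec)
      then show False using m by blast
    qed
    obtain c d where cd: "c \<in> K" "d \<in> K" "le4 (unit4 j) c" "le4 (unit4 j) d" "\<not> le4 c d" "\<not> le4 d c"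
    proof -
      have "j \<in> set [0,1,2,3]" using j less4_set by blast
      then show ?thesis using ideal_nonchain K(2) that by blast
    qed
    then have "vec c \<in> F" "vec d \<in> F" using up by blast+
    then have "root_le \<Delta> (vec c) (vec d) \<or> root_le \<Delta> (vec d) (vec c)"
      using peel(5) unfolding is_chain_def by blast
    then show False using cd root_le_vec by blast
  qed
qed

section \<open>Ideals omitting a generator\<close>

lemma down_restrict:
  assumes "down4 K" "j < 4"
  shows "down4 {c\<in>K. c ! j = 0}"
  unfolding down4_def
proof (intro conjI ballI impI)
  fix c d assume "c \<in> {c\<in>K. c ! j = 0}" "d \<in> set roots_F4" "le4 d c"
  moreover from this have "d ! j \<le> 0" using assms(2) unfolding le4_def less4_set by force
  ultimately show "d \<in> {c\<in>K. c ! j = 0}"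
    using assms roots_nonneg[of d j] by (force simp: down4_def)
qed (use assms in \<open>auto simp: down4_def\<close>)

lemma vec_diff: "K \<subseteq> set roots_F4 \<Longrightarrow> vec ` {c\<in>K. Q c} = vec ` K - vec ` {c\<in>K. \<not> Q c}"
  using vec_eq_iff roots_length by (auto simp: subset_iff image_iff)

lemma simple_positive: "j < 4 \<Longrightarrow> unit4 j ! j = 1"
  unfolding unit4_def by (subst nth_list_update_eq) auto

text \<open>Covers the degenerate case of both step lemmas: without \<open>\<alpha> j\<close> the
  block at \<open>j\<close> is empty, so it has no minimal element and does not raise the
  rank.\<close>

lemma restrict_trivial:
  assumes "down4 K" "j < 4" "unit4 j \<notin> K"
  shows "{c\<in>K. c ! j = 0} = K"
proof -
  have "c ! j = 0" if c: "c \<in> K" for c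
  proof (rule ccontr)
    assume "c ! j \<noteq> 0"
    moreover have r: "c \<in> set roots_F4" using assms c by (auto simp: down4_def)
    ultimately have "0 < c ! j" using roots_nonneg[OF r assms(2)] by simp
    then have "le4 (unit4 j) c" using unit_le r assms(2) less4_set by blast
    then show False using assms c unit_root[OF assms(2)] by (auto simp: down4_def)
  qed
  then show ?thesis by blast
qed

lemma chain_peelable_step:
  assumes K: "down4 K" and j: "j < 4"
    and chain: "\<And>c d. c \<in> K \<Longrightarrow> d \<in> K \<Longrightarrow> 0 < c ! j \<Longrightarrow> 0 < d ! j \<Longrightarrow> le4 c d \<or> le4 d c"
    and rest: "chain_peelable (root_le \<Delta>) (vec ` {c\<in>K. c ! j = 0})"
  shows "chain_peelable (root_le \<Delta>) (vec ` K)"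
\<comment> \<open>The rule \<open>peel\<close> requires a non-chain and a block containing a minimal
  element; both exceptions are settled first.\<close>
proof (cases "is_chain (root_le \<Delta>) (vec ` K) \<or> unit4 j \<notin> K")
  case True
  then show ?thesis
    using rest restrict_trivial[OF K j] chain_peeling.chain by (auto simp: chain_peelable_def)
next
  case False
  have KR: "K \<subseteq> set roots_F4" using K by (simp add: down4_def)
  define F where "F = vec ` {c\<in>K. c ! j \<noteq> 0}"
  have diff: "vec ` K - F = vec ` {c\<in>K. c ! j = 0}"
    unfolding F_def using vec_diff[OF KR, of "\<lambda>c. c ! j = 0"] by simp
  have filt: "order_filter (root_le \<Delta>) (vec ` K) F"
    unfolding order_filter_def order_ideal_def diff
  proof (intro conjI ballI impI)
    fix x y assume "x \<in> vec ` {c\<in>K. c ! j = 0}" "y \<in> vec ` K" "root_le \<Delta> y x \<and> y \<noteq> x"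
    then obtain c d where c: "c \<in> {c\<in>K. c ! j = 0}" and d: "d \<in> K" "y = vec d" and "le4 d c"
      by (auto simp: root_le_vec)
    then have "d \<in> {c\<in>K. c ! j = 0}"
      using down_restrict[OF K j] KR unfolding down4_def by blast
    then show "y \<in> vec ` {c\<in>K. c ! j = 0}" using d by blast
  qed (auto simp: F_def)
  have ch: "is_chain (root_le \<Delta>) F"
    unfolding is_chain_def F_def
  proof safe
    fix c d assume "c \<in> K" "d \<in> K" "c ! j \<noteq> 0" "d ! j \<noteq> 0" "\<not> root_le \<Delta> (vec d) (vec c)"
    then show "root_le \<Delta> (vec c) (vec d)"
      using chain[of c d] roots_nonneg[of c j] roots_nonneg[of d j] KR j
      by (force simp: root_le_vec)
  qed
  have mini: "\<exists>m\<in>F. minimal_in (root_le \<Delta>) (vec ` K) m"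
  proof (rule bexI)
    show "vec (unit4 j) \<in> F" using False simple_positive[OF j] by (auto simp: F_def)
    show "minimal_in (root_le \<Delta>) (vec ` K) (vec (unit4 j))"
      unfolding minimal_in_def
    proof (intro conjI notI)
      show "vec (unit4 j) \<in> vec ` K" using False by blast
      assume "\<exists>x\<in>vec ` K. root_le \<Delta> x (vec (unit4 j)) \<and> x \<noteq> vec (unit4 j)"
      then obtain c where c: "c \<in> K" "le4 c (unit4 j)" "c \<noteq> unit4 j"
        by (auto simp: root_le_vec)
      have "j \<in> set [0,1,2,3]" using j less4_set by blast
      then show False using unit_minimal c KR by blast
    qed
  qed
  obtain Bs where "chain_peeling (root_le \<Delta>) (vec ` K - F) Bs"
    using rest unfolding diff chain_peelable_def by blast
  then have "chain_peeling (root_le \<Delta>) (vec ` K) (Bs @ [F])"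
    using False by (intro chain_peeling.peel filt mini ch) auto
  then show ?thesis unfolding chain_peelable_def by blast
qed

text \<open>The roots involving \<open>\<alpha> j\<close> form the new block. It contains just one
  simple root, so the rank grows by one, and by \<open>chain_line\<close> the line through any two
  of its elements meets the rest of the ideal.\<close>

lemma supersolvable_step:
  assumes K: "down4 K" and j: "j < 4"
    and chain: "\<And>c d. c \<in> K \<Longrightarrow> d \<in> K \<Longrightarrow> 0 < c ! j \<Longrightarrow> 0 < d ! j \<Longrightarrow> le4 c d \<or> le4 d c"
    and rest: "supersolvable (vec ` {c\<in>K. c ! j = 0})"
  shows "supersolvable (vec ` K)"
proof (cases "unit4 j \<in> K")
  case False
  then show ?thesis using rest restrict_trivial[OF K j] by simp
next
  case True
  have KR: "K \<subseteq> set roots_F4" using K by (simp add: down4_def)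
  define K' where "K' = {c\<in>K. c ! j = 0}"
  define F where "F = vec ` {c\<in>K. c ! j \<noteq> 0}"
  have eq: "vec ` K = vec ` K' \<union> F" by (auto simp: K'_def F_def)
  have disj: "vec ` K' \<inter> F = {}"
    unfolding F_def K'_def using vec_diff[OF KR, of "\<lambda>c. c ! j = 0"] by blast
  have "unit4 i ! j = 0" if "i < 4" "i \<noteq> j" for i
    using that j by (auto simp: unit4_def nth_list_update less_Suc_eq numeral_eq_Suc)
  then have "{i. i < 4 \<and> unit4 i \<in> K} = insert j {i. i < 4 \<and> unit4 i \<in> K'}"
    using True j by (auto simp: K'_def)
  moreover have "unit4 j \<notin> K'" using simple_positive[OF j] by (simp add: K'_def)
  ultimately have dim: "dim (vec ` K) = Suc (dim (vec ` K'))"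
    using dim_down[OF K] dim_down[OF down_restrict[OF K j]] by (simp add: K'_def)
  have bad: "\<exists>z\<in>vec ` K'. z \<in> span {vec b, vec c}"
    if bc: "b \<in> K" "c \<in> K" "0 < b ! j" "0 < c ! j" "b \<noteq> c" "le4 b c" for b c
  proof -
    \<comment> \<open>All roots below \<open>c\<close> lie in the ideal \<open>K\<close>, so the
      chain hypothesis on \<open>K\<close> applies to them.\<close>
    have "\<forall>x\<in>set roots_F4. le4 x c \<and> 0 < x ! j \<longrightarrow>
        (\<forall>y\<in>set roots_F4. le4 y c \<and> 0 < y ! j \<longrightarrow> le4 x y \<or> le4 y x)"
      using chain K bc(2) by (metis down4_def)
    then obtain d k where d: "d \<in> set roots_F4" "le4 d c" "d ! j = 0" "k \<in> set [1,2,3,-1,-2,-3]"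
      "\<forall>i\<in>set [0,1,2,3]. k * d ! i = c ! j * b ! i - b ! j * c ! i"
      using chain_line[rule_format, of j c b] less4_set j bc KR by blast
    have "of_int k *\<^sub>R vec d = of_int (c ! j) *\<^sub>R vec b - of_int (b ! j) *\<^sub>R vec c"
      unfolding vec_def scaleR_sum_right sum_subtractf[symmetric] using d(5)[unfolded less4_set]
      by (intro sum.cong refl) (simp flip: of_int_mult of_int_diff scaleR_diff_left)
    also have "\<dots> \<in> span {vec b, vec c}" by (intro span_diff span_scale span_base) auto
    finally have "(1 / of_int k) *\<^sub>R (of_int k *\<^sub>R vec d) \<in> span {vec b, vec c}" by (rule span_scale)
    then have "vec d \<in> span {vec b, vec c}" using d(4) by auto
    moreover have "d \<in> K'" using d K bc by (auto simp: K'_def down4_def)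
    ultimately show ?thesis by blast
  qed
  have "\<not> (\<exists>X. k_flat (vec ` K) 2 X \<and> X \<subseteq> F)"
  proof
    assume "\<exists>X. k_flat (vec ` K) 2 X \<and> X \<subseteq> F"
    then obtain X where X: "vec ` K \<inter> span X = X" "dim X = 2" "X \<subseteq> F"
      by (auto simp: k_flat_def is_flat_def flat_closure_def)
    have "\<not> (\<exists>x. X \<subseteq> {x})"
    proof
      assume "\<exists>x. X \<subseteq> {x}"
      then obtain x where "X \<subseteq> {x}" by blast
      then have "dim X \<le> card {x}" by (meson dim_le_card' dim_subset finite.emptyI finite_insert order_trans)
      then show False using X by simp
    qed
    then obtain x y where xy: "x \<in> X" "y \<in> X" "x \<noteq> y" by blast
    obtain b where b: "b \<in> K" "b ! j \<noteq> 0" "x = vec b" using xy(1) X(3) unfolding F_def by blast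
    obtain c where c: "c \<in> K" "c ! j \<noteq> 0" "y = vec c" using xy(2) X(3) unfolding F_def by blast
    have bc: "b \<in> K" "c \<in> K" "b ! j \<noteq> 0" "c ! j \<noteq> 0" "vec b \<in> X" "vec c \<in> X" "b \<noteq> c"
      using b c xy by auto
    then have pos: "0 < b ! j" "0 < c ! j"
      using roots_nonneg[of b j] roots_nonneg[of c j] KR j by force+
    have "\<exists>z\<in>vec ` K'. z \<in> span {vec b, vec c}"
      using chain[OF bc(1,2) pos] bad[OF bc(1,2) pos bc(7)] bad[OF bc(2,1) pos(2,1) bc(7)[symmetric]]
      by (auto simp: insert_commute)
    moreover have "span {vec b, vec c} \<subseteq> span X" using bc by (intro span_mono) auto
    ultimately show False using X disj eq by blast
  qed
  then show ?thesis
    using supersolvable_extend[of "vec ` K'" F] rest disj dim eq by (simp add: K'_def)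
qed

text \<open>\<open>xs\<close> is only an upper bound for \<open>K\<close>, so a certificate for the
  largest ideal avoiding a root covers every smaller one.\<close>

lemma peel_order_sound:
  assumes "peel_order xs js" "down4 K" "K \<subseteq> set xs" "set js \<subseteq> {..<4}"
  shows "chain_peelable (root_le \<Delta>) (vec ` K) \<and> supersolvable (vec ` K)"
  using assms
proof (induction xs js arbitrary: K rule: peel_order.induct)
  case (1 xs)
  \<comment> \<open>The empty set is a chain, and it has rank 0 with a partition into no
    blocks.\<close>
  then have "K = {}" by simp
  moreover have "chain_peelable (root_le \<Delta>) {}"
    unfolding chain_peelable_def using chain_peeling.chain[of _ "{}"] by (auto simp: is_chain_def)
  moreover have "supersolvable ({} :: 'a set)"
    unfolding supersolvable_def by (simp add: disjoint_family_on_def)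
  ultimately show ?case by simp
next
  case (2 xs j js)
  have j: "j < 4" using 2 by simp
  have "chain_peelable (root_le \<Delta>) (vec ` {c\<in>K. c ! j = 0}) \<and> supersolvable (vec ` {c\<in>K. c ! j = 0})"
    using 2 by (intro "2.IH" down_restrict[OF _ j]) auto
  moreover have "le4 c d \<or> le4 d c" if "c \<in> K" "d \<in> K" "0 < c ! j" "0 < d ! j" for c d
    using that "2.prems"(1,3) by auto
  ultimately show ?case
    using chain_peelable_step[OF "2.prems"(2) j] supersolvable_step[OF "2.prems"(2) j] by simp
qed

lemma ideal_peelable_supersolvable:
  assumes K: "down4 K" "\<not> set gens4 \<subseteq> K"
  shows "chain_peelable (root_le \<Delta>) (vec ` K) \<and> supersolvable (vec ` K)"
proof -
  obtain e js where e: "e \<notin> K" "e \<in> set roots_F4" "set js \<subseteq> {..<4}"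
    "peel_order (filter (\<lambda>c. \<not> le4 e c) roots_F4) js"
  proof -
    have "\<exists>(e, js)\<in>set [([1,2,1,0], [0,3,1,2]), ([1,1,1,1], [0,3,1,2]), ([0,2,1,1], [3,0,1,2])]. e \<notin> K"
      using K(2) by (auto simp: gens4_def)
    moreover have "\<forall>(e, js)\<in>set [([1,2,1,0], [0,3,1,2]), ([1,1,1,1], [0,3,1,2]), ([0,2,1,1], [3,0,1,2::nat])].
        e \<in> set roots_F4 \<and> set js \<subseteq> {..<4}"
      by (auto simp: roots_F4_def)
    ultimately show ?thesis using peel_orders that by blast
  qed
  \<comment> \<open>An ideal avoiding \<open>e\<close> contains nothing above
    \<open>e\<close>.\<close>
  have "K \<subseteq> set (filter (\<lambda>c. \<not> le4 e c) roots_F4)"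
    using K(1) e(1,2) by (auto simp: down4_def)
  then show ?thesis using peel_order_sound[OF e(4) K(1)] e(3) by blast
qed

text \<open>The generators have height at most 4, and every positive root of height at most 4 lies
  below one of them.\<close>

lemma low_roots_subset_iff:
  assumes K: "down4 K"
  shows "{\<gamma> \<in> positive_roots \<Phi> \<Delta>. root_height \<Delta> \<gamma> \<le> 4} \<subseteq> vec ` K \<longleftrightarrow>
    set gens4 \<subseteq> K"
proof -
  have KR: "K \<subseteq> set roots_F4" using K by (simp add: down4_def)
  have mem: "vec c \<in> vec ` K \<longleftrightarrow> c \<in> K" if "c \<in> set roots_F4" for c
    using that KR vec_eq_iff roots_length by (metis (no_types, lifting) imageE imageI subsetD)
  have ht: "root_height \<Delta> (vec c) \<le> 4 \<longleftrightarrow> sum_list c \<le> 4" if "c \<in> set roots_F4" for c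
    using that by (simp add: root_height_vec roots_length flip: of_int_le_iff)
  have "{\<gamma> \<in> positive_roots \<Phi> \<Delta>. root_height \<Delta> \<gamma> \<le> 4} \<subseteq> vec ` K \<longleftrightarrow>
      (\<forall>c\<in>set roots_F4. sum_list c \<le> 4 \<longrightarrow> c \<in> K)"
    unfolding positive_roots_eq using mem ht by blast
  also have "\<dots> \<longleftrightarrow> set gens4 \<subseteq> K"
    using generators_height low_root_le_gens K unfolding down4_def by (auto 0 4)
  finally show ?thesis .
qed

end

theorem theorem7p2:
  fixes \<Phi> \<Delta> I :: "'a::euclidean_space set"
  assumes "root_system \<Phi>"
    and "simple_system \<Phi> \<Delta>"
    and "type_F4 \<Delta>"
    and "order_ideal (root_le \<Delta>) (positive_roots \<Phi> \<Delta>) I"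
  shows "(supersolvable I \<longleftrightarrow> chain_peelable (root_le \<Delta>) I) \<and>
         (chain_peelable (root_le \<Delta>) I \<longleftrightarrow>
            \<not> {\<gamma> \<in> positive_roots \<Phi> \<Delta>. root_height \<Delta> \<gamma> \<le> 4} \<subseteq> I)"
proof -
  obtain \<alpha> where "bij_betw \<alpha> {..<4} \<Delta>"
    "\<forall>i<4. \<forall>j<4. cartan_number (\<alpha> i) (\<alpha> j) = of_int (cartan_matrix_F4 ! i ! j)"
    using assms(3) unfolding type_F4_def by blast
  then interpret F4_roots \<Phi> \<Delta> \<alpha> using assms by unfold_locales auto
  \<comment> \<open>The ideal is pulled back to coefficient lists, where the finite checks
    apply.\<close>
  define K where "K = {c\<in>set roots_F4. vec c \<in> I}"
  have I: "I = vec ` K"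
    using assms(4) unfolding K_def order_ideal_def positive_roots_eq by blast
  have "down4 K"
    using assms(4) unfolding down4_def K_def order_ideal_def positive_roots_eq
    by (auto simp: root_le_vec) (metis root_le_vec)
  then show ?thesis
    unfolding I low_roots_subset_iff[OF \<open>down4 K\<close>]
    using ideal_peelable_supersolvable ideal_not_supersolvable ideal_not_peelable by blast
qed

end
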